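(* Let $d\ge 2$ and let $\mathcal{A}$ be any monotone algorithm that solves the streaming ellipsoidal rounding problem with approximation factor $1/\alpha_n$. Then there exists a sequence of points $\bm{z}_1,\dots,\bm{z}_n\in\mathbb{R}^d$ such that, on $Z=\mathrm{conv}\{\bm{z}_1,\dots,\bm{z}_n\}$, the algorithm $\mathcal{A}$ gets an approximation factor \[\frac{1}{\alpha_n}\ \ge\ \Omega\!\left(\frac{d\log\kappa(Z)}{\log d}\right).\]
   Context: Streaming ellipsoidal rounding problem: points $\bm{z}_1,\dots,\bm{z}_n\in\mathbb{R}^d$ arrive one at a time; after each point $t$ the algorithm outputs an origin-centered ellipsoid $\mathcal{E}_t$ (image of $B_2^d$ under a nonsingular linear map), a center $\bm{c}_t$ and a scaling $\alpha_t\in(0,1]$, and at the end of the stream it must hold that $\bm{c}_n+\alpha_n\mathcal{E}_n\subseteq Z\subseteq\bm{c}_n+\mathcal{E}_n$; $1/\alpha_n$ is its approximation factor. An algorithm is monotone if, for any initial $(\bm{c}_0+\mathcal{E}_0,\alpha_0)$ and any sequence of points, the resulting sequence of outputs satisfies for every $t$: (i) $\bm{c}_t+\mathcal{E}_t\supseteq\mathrm{conv}\big((\bm{c}_{t-1}+\mathcal{E}_{t-1})\cup\{\bm{z}_t\}\big)$ and (ii) $\bm{c}_t+\alpha_t\mathcal{E}_t\subseteq\mathrm{conv}\big((\bm{c}_{t-1}+\alpha_{t-1}\mathcal{E}_{t-1})\cup\{\bm{z}_t\}\big)$. For a convex body $K$: the inradius $r(K)$ is the largest $r$ such that some point $\bm{c}$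 satisfies $\bm{c}+r\cdot(B_2^d\cap\mathrm{span}(K-\bm{c}))\subseteq K$; the circumradius $R(K)$ is the smallest $R$ such that some $\bm{c}$ satisfies $K\subseteq\bm{c}+R\cdot B_2^d$; the aspect ratio is $\kappa(K)=R(K)/r(K)$. $\Omega(\cdot)$ hides absolute constants. *)

theory Defs
  imports "HOL-Analysis.Analysis"
begin

text \<open>
  The constant hidden in the asymptotic bound must not depend on the dimension, so the dimension
  has to be a number that is quantified inside the theorem and not a type. All spaces
  \<open>\<real>\<^sup>d\<close> are therefore realised inside one real inner product space, the
  finitely supported real sequences with the Euclidean inner product; \<open>\<real>\<^sup>d\<close> is the
  subspace of sequences supported on the first \<open>d\<close> coordinates.
\<close>

typedef fseq = "{f :: nat \<Rightarrow> real. finite {i. f i \<noteq> 0}}"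
  morphisms coord Abs_fseq
  by (rule exI[of _ "\<lambda>_. 0"]) simp

setup_lifting type_definition_fseq

lemma finite_coord: "finite {i. coord x i \<noteq> 0}"
  using coord[of x] by simp

lemma fseq_eqI: "(\<And>i. coord x i = coord y i) \<Longrightarrow> x = y"
  by (simp add: coord_inject[symmetric] fun_eq_iff)

instantiation fseq :: real_vector
begin

lift_definition zero_fseq :: fseq is "\<lambda>_. 0"
  by simp

lift_definition plus_fseq :: "fseq \<Rightarrow> fseq \<Rightarrow> fseq" is "\<lambda>f g i. f i + g i"
  subgoal for f g
    by (rule finite_subset[of _ "{i. f i \<noteq> 0} \<union> {i. g i \<noteq> 0}"]) auto
  done

lift_definition minus_fseq :: "fseq \<Rightarrow> fseq \<Rightarrow> fseq" is "\<lambda>f g i. f i - g i"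
  subgoal for f g
    by (rule finite_subset[of _ "{i. f i \<noteq> 0} \<union> {i. g i \<noteq> 0}"]) auto
  done

lift_definition uminus_fseq :: "fseq \<Rightarrow> fseq" is "\<lambda>f i. - f i"
  by simp

lift_definition scaleR_fseq :: "real \<Rightarrow> fseq \<Rightarrow> fseq" is "\<lambda>a f i. a * f i"
  by simp

instance
  by standard (rule fseq_eqI; simp add: zero_fseq.rep_eq plus_fseq.rep_eq minus_fseq.rep_eq
    uminus_fseq.rep_eq scaleR_fseq.rep_eq algebra_simps)+

end

lemmas coord_simps = zero_fseq.rep_eq plus_fseq.rep_eq minus_fseq.rep_eq uminus_fseq.rep_eq
  scaleR_fseq.rep_eq

instantiation fseq :: real_inner
begin

definition inner_fseq :: "fseq \<Rightarrow> fseq \<Rightarrow> real"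
  where "inner_fseq x y = (\<Sum>i | coord x i \<noteq> 0. coord x i * coord y i)"

definition norm_fseq :: "fseq \<Rightarrow> real"
  where "norm_fseq x = sqrt (inner x x)"

definition sgn_fseq :: "fseq \<Rightarrow> fseq"
  where "sgn_fseq x = x /\<^sub>R norm x"

definition dist_fseq :: "fseq \<Rightarrow> fseq \<Rightarrow> real"
  where "dist_fseq x y = norm (x - y)"

definition uniformity_fseq :: "(fseq \<times> fseq) filter"
  where "uniformity_fseq = (INF e\<in>{0<..}. principal {(x, y). dist x y < e})"

definition open_fseq :: "fseq set \<Rightarrow> bool"
  where "open_fseq U \<longleftrightarrow> (\<forall>x\<in>U. \<forall>\<^sub>F (x', y) in uniformity. x' = x \<longrightarrow> y \<in> U)"

lemma inner_fseq_superset: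
  assumes "finite I" "{i. coord x i \<noteq> 0} \<subseteq> I"
  shows "inner x y = (\<Sum>i\<in>I. coord x i * coord y i)"
  unfolding inner_fseq_def using assms by (intro sum.mono_neutral_left) auto

instance
proof
  fix x y z :: fseq and r :: real and U :: "fseq set"
  define I where "I = {i. coord x i \<noteq> 0} \<union> {i. coord y i \<noteq> 0}"
  have I: "finite I" by (simp add: I_def finite_coord)
  have ip: "inner u v = (\<Sum>i\<in>I. coord u i * coord v i)"
    if "\<And>i. coord x i = 0 \<Longrightarrow> coord y i = 0 \<Longrightarrow> coord u i = 0" for u v
    using that by (intro inner_fseq_superset I) (auto simp: I_def)
  show "dist x y = norm (x - y)" by (rule dist_fseq_def)
  show "sgn x = x /\<^sub>R norm x" by (rule sgn_fseq_def)
  show "uniformity = (INF e\<in>{0<..}. principal {(x, y :: fseq). dist x y < e})"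
    by (rule uniformity_fseq_def)
  show "open U \<longleftrightarrow> (\<forall>x\<in>U. \<forall>\<^sub>F (x', y) in uniformity. x' = x \<longrightarrow> y \<in> U)"
    by (rule open_fseq_def)
  show "norm x = sqrt (inner x x)" by (rule norm_fseq_def)
  show "inner x y = inner y x" by (simp add: ip mult.commute)
  show "inner (x + y) z = inner x z + inner y z"
    by (simp add: ip coord_simps sum.distrib algebra_simps)
  show "inner (r *\<^sub>R x) y = r * inner x y"
    by (simp add: ip coord_simps sum_distrib_left algebra_simps)
  show "0 \<le> inner x x" by (simp add: inner_fseq_def sum_nonneg)
  show "inner x x = 0 \<longleftrightarrow> x = 0"
    by (auto simp: inner_fseq_def sum_nonneg_eq_0_iff finite_coord coord_simps intro!: fseq_eqI)
qed

end

definition Rd :: "nat \<Rightarrow> fseq set"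
  where "Rd d = {x. \<forall>i\<ge>d. coord x i = 0}"

definition unit_ball :: "nat \<Rightarrow> fseq set"
  where "unit_ball d = cball 0 1 \<inter> Rd d"

definition ellipsoid :: "nat \<Rightarrow> fseq set \<Rightarrow> bool"
  where "ellipsoid d E \<longleftrightarrow> (\<exists>T. linear T \<and> bij_betw T (Rd d) (Rd d) \<and> E = T ` unit_ball d)"

record rounding =
  center :: fseq
  ellips :: "fseq set"
  scaling :: real

definition valid_rounding :: "nat \<Rightarrow> rounding \<Rightarrow> bool"
  where "valid_rounding d s \<longleftrightarrow>
    center s \<in> Rd d \<and> ellipsoid d (ellips s) \<and> 0 < scaling s \<and> scaling s \<le> 1"

definition outer_body :: "rounding \<Rightarrow> fseq set"
  where "outer_body s = (\<lambda>x. center s + x) ` ellips s"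

definition inner_body :: "rounding \<Rightarrow> fseq set"
  where "inner_body s = (\<lambda>x. center s + scaling s *\<^sub>R x) ` ellips s"

text \<open>
  An algorithm maps an initial rounding and the list of points received so far to its current
  output, so the output at time \<open>t\<close> cannot depend on later points.
\<close>

type_synonym algorithm = "rounding \<Rightarrow> fseq list \<Rightarrow> rounding"

definition streaming_algorithm :: "nat \<Rightarrow> algorithm \<Rightarrow> bool"
  where "streaming_algorithm d A \<longleftrightarrow>
    (\<forall>s. valid_rounding d s \<longrightarrow>
      A s [] = s \<and> (\<forall>zs. set zs \<subseteq> Rd d \<longrightarrow> valid_rounding d (A s zs)))"

definition monotone_algorithm :: "nat \<Rightarrow> algorithm \<Rightarrow> bool"
  where "monotone_algorithm d A \<longleftrightarrow>
    (\<forall>s zs z. valid_rounding d s \<longrightarrow> set zs \<subseteq> Rd d \<longrightarrow> z \<in> Rd d \<longrightarrow>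
      convex hull (outer_body (A s zs) \<union> {z}) \<subseteq> outer_body (A s (zs @ [z])) \<and>
      inner_body (A s (zs @ [z])) \<subseteq> convex hull (inner_body (A s zs) \<union> {z}))"

text \<open>
  A stream is admissible for an initial rounding if the initial inner ellipsoid lies in the convex
  hull of the stream. Without an assumption of this kind no algorithm could solve the problem,
  because the inner ellipsoid is full-dimensional whereas the hull of a short stream is not.
\<close>

definition admissible_stream :: "nat \<Rightarrow> rounding \<Rightarrow> fseq list \<Rightarrow> bool"
  where "admissible_stream d s zs \<longleftrightarrow>
    set zs \<subseteq> Rd d \<and> inner_body s \<subseteq> convex hull (set zs)"

definition solves_rounding :: "nat \<Rightarrow> algorithm \<Rightarrow> bool"
  where "solves_rounding d A \<longleftrightarrow>
    (\<forall>s zs. valid_rounding d s \<longrightarrow> admissible_stream d s zs \<longrightarrow>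
      inner_body (A s zs) \<subseteq> convex hull (set zs) \<and>
      convex hull (set zs) \<subseteq> outer_body (A s zs))"

text \<open>
  For a compact convex set with more than one point the supremum and the infimum below are attained.
\<close>

definition inradius :: "nat \<Rightarrow> fseq set \<Rightarrow> real"
  where "inradius d K = Sup {r. 0 \<le> r \<and> (\<exists>c\<in>Rd d.
    (\<lambda>x. c + r *\<^sub>R x) ` (unit_ball d \<inter> span ((\<lambda>y. y - c) ` K)) \<subseteq> K)}"

definition circumradius :: "nat \<Rightarrow> fseq set \<Rightarrow> real"
  where "circumradius d K = Inf {R. 0 \<le> R \<and> (\<exists>c\<in>Rd d.
    K \<subseteq> (\<lambda>x. c + R *\<^sub>R x) ` unit_ball d)}"

definition aspect_ratio :: "nat \<Rightarrow> fseq set \<Rightarrow> real"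
  where "aspect_ratio d K = circumradius d K / inradius d K"

end

theory Submission
  imports Defs "HOL-Real_Asymp.Real_Asymp"
begin

text \<open>
  The adversary plays \<open>z = c + 2 r e\<^sub>j\<close>, where \<open>r e\<^sub>j\<close> is the boundary point of
  the current ellipsoid on the axis \<open>j < d - 1\<close> and \<open>r < R\<close>. Monotonicity then forces
  \<open>1/\<alpha>\<close> to increase by some \<open>D \<ge> 1/6\<close>, whereas the half-width of the ellipsoid
  grows by a factor of at most \<open>\<alpha>/\<alpha>'\<close> in the coordinates other than \<open>j\<close> and at
  most \<open>23 D\<close> in coordinate \<open>j\<close>. Hence the sum of the logarithms of the first
  \<open>d - 1\<close> half-widths, which replaces the volume, is at most a constant plus
  \<open>23/\<alpha> + d ln (1/\<alpha>)\<close>. When no move with \<open>r < R\<close> is left, this sum is at least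
  \<open>(d - 1) ln R\<close>, so \<open>1/\<alpha>\<close> is at least of order \<open>d ln R\<close> for large
  \<open>R\<close>. The last coordinate of the points never grows, so the inradius stays bounded; the
  centers lie in the hull of the stream, so every move enlarges it by at most \<open>2 R\<close>, and there
  are only \<open>O(d ln R)\<close> moves. The aspect ratio is therefore at most \<open>R\<^sup>2\<close>. This
  even gives a bound without the factor \<open>1 / ln d\<close>.
\<close>

text \<open>
  One round in coordinates where the old ellipsoid is the unit ball of \<open>V\<close> around \<open>0\<close>;
  \<open>c + K\<close> is the new outer body, and \<open>\<alpha>\<close>, \<open>\<beta>\<close> are the old and new scalings.
\<close>

lemma rounding_step:
  fixes c z w :: "'a::real_inner"
  assumes V: "subspace V" and zV: "z \<in> V" and nz: "norm z = 2"
    and wV: "w \<in> V" and nw: "norm w = 1" and wz: "inner w z = 0"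
    and al: "0 < \<alpha>" "\<alpha> \<le> 1" and be: "0 < \<beta>"
    and sym: "\<And>k. k \<in> K \<Longrightarrow> - k \<in> K"
    and outb: "\<And>b. b \<in> V \<Longrightarrow> norm b \<le> 1 \<Longrightarrow> b - c \<in> K"
    and outz: "z - c \<in> K"
    and inn: "\<And>k. k \<in> K \<Longrightarrow> \<exists>l b. 0 \<le> l \<and> l \<le> 1 \<and> norm b \<le> 1 \<and>
        c + \<beta> *\<^sub>R k = ((1 - l) * \<alpha>) *\<^sub>R b + l *\<^sub>R z"
  shows "\<beta> \<le> \<alpha>" and "1/6 \<le> 1/\<beta> - 1/\<alpha>"
    and "\<And>l b. 0 \<le> l \<Longrightarrow> l \<le> 1 \<Longrightarrow> norm b \<le> 1 \<Longrightarrow> c = ((1 - l) * \<alpha>) *\<^sub>R b + l *\<^sub>R z \<Longrightarrow>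
        l/\<beta> - (\<alpha>/\<beta>)/2 \<le> 1/\<beta> - 1/\<alpha>"
proof -
  \<comment> \<open>A support function bound: in a direction where \<open>z\<close> is no higher
    than \<open>\<alpha>\<close>, the hull of \<open>z\<close> and the ball of radius
    \<open>\<alpha>\<close> does not exceed \<open>\<alpha>\<close> either.\<close>
  have supp: "inner v c + \<beta> * inner v k \<le> \<alpha>"
    if k: "k \<in> K" and v: "norm v \<le> 1" "inner v z \<le> \<alpha>" for v k
  proof -
    obtain l b where lb: "0 \<le> l" "l \<le> 1" "norm b \<le> 1"
      "c + \<beta> *\<^sub>R k = ((1 - l) * \<alpha>) *\<^sub>R b + l *\<^sub>R z" using inn[OF k] by blast
    have "inner v c + \<beta> * inner v k = inner v (c + \<beta> *\<^sub>R k)" by (simp add: inner_right_distrib)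
    also have "\<dots> = (1 - l) * \<alpha> * inner v b + l * inner v z"
      unfolding lb(4) by (simp add: inner_right_distrib)
    also have "inner v b \<le> 1"
      using norm_cauchy_schwarz[of v b] mult_mono[OF v(1) lb(3)] by simp
    hence "(1 - l) * \<alpha> * inner v b + l * inner v z \<le> (1 - l) * \<alpha> * 1 + l * \<alpha>"
      using lb al v(2) by (intro add_mono mult_left_mono) auto
    finally show ?thesis by (simp add: algebra_simps)
  qed
  \<comment> \<open>Both \<open>v - c\<close> and, by symmetry, \<open>v + c\<close> lie in
    \<open>K\<close>; averaging the two bounds from \<open>supp\<close> cancels the product of
    \<open>\<beta>\<close> and \<open>inner v c\<close>.\<close>
  have supp1: "inner v c + \<beta> \<le> \<alpha>" if "v \<in> V" "norm v = 1" "inner v z \<le> \<alpha>" for v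
  proof -
    have k1: "v - c \<in> K" using outb that by simp
    have "- (- v - c) \<in> K" using outb[of "- v"] that V by (intro sym) (simp add: subspace_neg)
    hence k2: "v + c \<in> K" by (simp add: add.commute)
    have vv: "inner v v = 1" using that(2) by (simp add: norm_eq_1)
    have "inner v c + \<beta> * (1 - inner v c) \<le> \<alpha>"
      using supp[OF k1, of v] that vv by (simp add: inner_diff_right)
    moreover have "inner v c + \<beta> * (1 + inner v c) \<le> \<alpha>"
      using supp[OF k2, of v] that vv by (simp add: inner_add_right)
    ultimately show ?thesis by (simp add: algebra_simps)
  qed
  obtain w' where w': "w' \<in> V" "norm w' = 1" "inner w' z = 0" "inner w' c \<ge> 0"
  proof (cases "inner w c \<ge> 0")
    case True thus ?thesis using that[of w] wV nw wz by simp
  next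
    case False thus ?thesis using that[of "- w"] wV nw wz V by (simp add: subspace_neg)
  qed
  show le: "\<beta> \<le> \<alpha>" using supp1[of w'] w' al by simp
  define u where "u = z /\<^sub>R 2"
  define g where "g = inner u c"
  have u: "u \<in> V" "norm u = 1" "inner u z = 2" "inner u w' = 0" "inner w' u = 0"
    using V zV nz w' dot_square_norm[of z]
    by (auto simp: u_def subspace_scale inner_commute)
  have uu: "inner u u = 1" using u by (simp add: norm_eq_1)
  have ww: "inner w' w' = 1" using w' by (simp add: norm_eq_1)
  define t where "t = sqrt (1 - (\<alpha>/2)\<^sup>2)"
  have "(\<alpha>/2)\<^sup>2 \<le> 1" using al by (intro power_le_one) auto
  hence t: "t \<ge> 0" "t\<^sup>2 = 1 - (\<alpha>/2)\<^sup>2" by (auto simp: t_def)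
  \<comment> \<open>The unit normal of a hyperplane through \<open>z\<close> tangent to the inner ball: by \<open>cone\<close> below, moving the
    center towards \<open>z\<close> costs scaling.\<close>
  define v where "v = (\<alpha>/2) *\<^sub>R u + t *\<^sub>R w'"
  have "inner v v = (\<alpha>/2)\<^sup>2 + t\<^sup>2"
    using u uu ww by (simp add: v_def inner_add_left inner_add_right power2_eq_square)
  hence v: "v \<in> V" "norm v = 1" "inner v z = \<alpha>"
    using u w' t V by (auto simp: norm_eq_1 v_def subspace_add subspace_scale inner_add_left)
  have "\<alpha>/2 * g \<le> inner v c"
    using w' t by (simp add: v_def inner_add_left g_def)
  hence cone: "\<alpha> * g / 2 + \<beta> \<le> \<alpha>" using supp1[of v] v by simp
  have D: "g / (2 * \<beta>) \<le> 1/\<beta> - 1/\<alpha>"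
  proof -
    have "(1/\<beta> - 1/\<alpha>) - g / (2 * \<beta>) = (\<alpha> - \<beta> - \<alpha> * g / 2) / (\<alpha> * \<beta>)"
      using al be by (simp add: field_simps)
    also have "\<dots> \<ge> 0" using cone al be by simp
    finally show ?thesis by simp
  qed
  \<comment> \<open>Along \<open>u\<close> the points \<open>z\<close> and \<open>- u\<close> are 3
    apart, so \<open>K\<close> has half-width at least \<open>3/2\<close>; adding \<open>1\<close>
    and \<open>2\<close> uses this wherever the center lies.\<close>
  have "- (z - c) \<in> K" using outz sym by blast
  from supp[OF this, of "- u"] have 1: "- g + \<beta> * (2 - g) \<le> \<alpha>"
    using u al by (simp add: g_def inner_diff_right)
  have "- u - c \<in> K" using outb[of "- u"] u V by (simp add: subspace_neg)
  from supp[OF this, of "- u"] have 2: "- g + \<beta> * (1 + g) \<le> \<alpha>"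
    using u al uu by (simp add: g_def inner_diff_right algebra_simps)
  have "3/2 * \<beta> - \<alpha> \<le> g" using 1 2 by (simp add: algebra_simps)
  hence "(3/2 * \<beta> - \<alpha>) / (2 * \<beta>) \<le> g / (2 * \<beta>)" using be by (intro divide_right_mono) auto
  moreover have "(3/2 * \<beta> - \<alpha>) / (2 * \<beta>) = (3/2 - \<alpha>/\<beta>)/2" using be by (simp add: field_simps)
  ultimately have "(3/2 - \<alpha>/\<beta>)/2 \<le> 1/\<beta> - 1/\<alpha>" using D by linarith
  moreover have "\<alpha>/\<beta> - 1 \<le> 1/\<beta> - 1/\<alpha>"
  proof -
    have "(1/\<beta> - 1/\<alpha>) - (\<alpha>/\<beta> - 1) = (\<alpha> - \<beta>) * (1 - \<alpha>) / (\<alpha> * \<beta>)"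
      using al be by (simp add: field_simps)
    also have "\<dots> \<ge> 0" using le al be by simp
    finally show ?thesis by simp
  qed
  \<comment> \<open>With \<open>p\<close> for \<open>\<alpha>/\<beta>\<close> and \<open>x\<close>
    for the increase, \<open>3/2 - p \<le> 2 * x\<close> and \<open>p - 1 \<le> x\<close> add up to
    \<open>1/2 \<le> 3 * x\<close>.\<close>
  ultimately show "1/6 \<le> 1/\<beta> - 1/\<alpha>" by simp
  \<comment> \<open>A weight \<open>l\<close> on \<open>z\<close> forces \<open>g\<close> to be at
    least \<open>2 * l - \<alpha>\<close>, and \<open>D\<close> bounds \<open>g\<close> from
    above.\<close>
  fix l b assume lb: "0 \<le> l" "l \<le> 1" "norm b \<le> 1" "c = ((1 - l) * \<alpha>) *\<^sub>R b + l *\<^sub>R z"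
  have ub: "- 1 \<le> inner u b"
    using Cauchy_Schwarz_ineq2[of u b] u lb by simp
  have "g = (1 - l) * \<alpha> * inner u b + 2 * l"
    unfolding g_def lb(4) using u by (simp add: inner_add_right)
  also have "\<dots> \<ge> (1 - l) * \<alpha> * (-1) + 2 * l"
    using lb al ub by (intro add_mono mult_left_mono) auto
  also have "(1 - l) * \<alpha> * (-1) + 2 * l \<ge> 2 * l - \<alpha>" using lb al by (simp add: algebra_simps)
  finally have "(2 * l - \<alpha>) / (2 * \<beta>) \<le> g / (2 * \<beta>)" using be by (intro divide_right_mono) auto
  moreover have "(2 * l - \<alpha>) / (2 * \<beta>) = l/\<beta> - (\<alpha>/\<beta>)/2" using be by (simp add: field_simps)
  ultimately show "l/\<beta> - (\<alpha>/\<beta>)/2 \<le> 1/\<beta> - 1/\<alpha>" using D by linarith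
qed

section \<open>Unit vectors and coordinates of finitely supported sequences\<close>

definition unit_vec :: "nat \<Rightarrow> fseq"
  where "unit_vec i = Abs_fseq (\<lambda>k. if k = i then 1 else 0)"

lemma coord_unit_vec [simp]: "coord (unit_vec i) k = (if k = i then 1 else 0)"
  unfolding unit_vec_def by (subst Abs_fseq_inverse) auto

lemma linear_coord: "linear (\<lambda>x. coord x i)"
  by (rule linearI) (simp_all add: coord_simps)

lemma coord_sum: "coord (sum f I) i = (\<Sum>k\<in>I. coord (f k) i)"
  using linear_sum[OF linear_coord] .

lemma inner_unit_vec [simp]: "inner (unit_vec i) x = coord x i"
proof -
  have "inner (unit_vec i) x = (\<Sum>k\<in>{i}. coord (unit_vec i) k * coord x k)"
    by (rule inner_fseq_superset) auto
  thus ?thesis by simp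
qed

lemma norm_unit_vec [simp]: "norm (unit_vec i) = 1"
  by (simp add: norm_eq_1)

lemma abs_coord_le_norm: "\<bar>coord x i\<bar> \<le> norm x"
  using Cauchy_Schwarz_ineq2[of "unit_vec i" x] by simp

lemma subspace_Rd: "subspace (Rd d)"
  by (auto simp: subspace_def Rd_def coord_simps)

lemma unit_vec_in_Rd [simp]: "i < d \<Longrightarrow> unit_vec i \<in> Rd d"
  by (auto simp: Rd_def)

lemma Rd_expansion: "x \<in> Rd d \<Longrightarrow> x = (\<Sum>i<d. coord x i *\<^sub>R unit_vec i)"
  by (rule fseq_eqI) (auto simp: coord_sum coord_simps Rd_def if_distrib cong: if_cong)

text \<open>Supplies the direction \<open>w\<close> of \<open>rounding_step\<close>. A quarter turn
  in the plane of the first two coordinates suffices, which is where \<open>d \<ge> 2\<close>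
  enters.\<close>

lemma Rd_orthogonal_unit_vector:
  assumes "d \<ge> 2" "z \<in> Rd d"
  obtains w where "w \<in> Rd d" "norm w = 1" "inner w z = 0"
proof -
  obtain y where y: "y \<in> Rd d" "inner y z = 0" "y \<noteq> 0"
  proof (cases "coord z 0 = 0")
    case True
    have "unit_vec 0 \<noteq> (0 :: fseq)" using norm_unit_vec[of 0] by force
    thus ?thesis using that[of "unit_vec 0"] True assms by simp
  next
    case False
    let ?y = "coord z 1 *\<^sub>R unit_vec 0 - coord z 0 *\<^sub>R unit_vec 1"
    have "coord ?y 1 = - coord z 0" by (simp add: coord_simps)
    hence "?y \<noteq> 0" using False by (metis neg_equal_0_iff_equal zero_fseq.rep_eq)
    thus ?thesis using that[of ?y] assms subspace_Rd[of d]
      by (simp add: inner_diff_left subspace_diff subspace_scale)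
  qed
  show ?thesis
    using that[of "y /\<^sub>R norm y"] y subspace_Rd[of d] by (simp add: subspace_scale)
qed

section \<open>Ellipsoids and inner bodies\<close>

lemma neg_in_unit_ball: "x \<in> unit_ball d \<Longrightarrow> - x \<in> unit_ball d"
  by (auto simp: unit_ball_def subspace_neg subspace_Rd)

lemma zero_in_unit_ball: "0 \<in> unit_ball d"
  by (simp add: unit_ball_def subspace_0 subspace_Rd)

lemma convex_unit_ball: "convex (unit_ball d)"
  unfolding unit_ball_def by (intro convex_Int convex_cball subspace_imp_convex subspace_Rd)

lemma ellipsoid_symmetric: "ellipsoid d E \<Longrightarrow> x \<in> E \<Longrightarrow> - x \<in> E"
  unfolding ellipsoid_def by (auto simp: linear_neg[symmetric] neg_in_unit_ball)

lemma ellipsoid_zero: "ellipsoid d E \<Longrightarrow> 0 \<in> E"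
  unfolding ellipsoid_def using zero_in_unit_ball linear_0 by force

lemma ellipsoid_convex: "ellipsoid d E \<Longrightarrow> convex E"
  unfolding ellipsoid_def using convex_unit_ball convex_linear_image by blast

lemma ellipsoid_subset_Rd: "ellipsoid d E \<Longrightarrow> E \<subseteq> Rd d"
  unfolding ellipsoid_def unit_ball_def bij_betw_def by auto

text \<open>The ambient space is infinite-dimensional, so a linear map on it need not be bounded; on
  \<open>Rd d\<close> the images of \<open>d\<close> unit vectors control it. A bound of at least 1
  has a nonnegative logarithm.\<close>

lemma ellipsoid_bounded:
  assumes "ellipsoid d E"
  obtains b where "b \<ge> 1" "\<And>x. x \<in> E \<Longrightarrow> norm x \<le> b"
proof -
  obtain T where T: "linear T" "E = T ` unit_ball d" using assms by (auto simp: ellipsoid_def)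
  define b where "b = (\<Sum>i<d. norm (T (unit_vec i)))"
  have "norm (T x) \<le> b" if "x \<in> unit_ball d" for x
  proof -
    have x: "x \<in> Rd d" "norm x \<le> 1" using that by (auto simp: unit_ball_def)
    have "T x = (\<Sum>i<d. coord x i *\<^sub>R T (unit_vec i))"
      by (subst Rd_expansion[OF x(1)]) (simp add: linear_sum[OF T(1)] linear_scale[OF T(1)])
    also have "norm \<dots> \<le> (\<Sum>i<d. norm (coord x i *\<^sub>R T (unit_vec i)))" by (rule norm_sum)
    also have "\<dots> \<le> b" unfolding b_def
    proof (rule sum_mono)
      fix i
      have "\<bar>coord x i\<bar> \<le> 1" using abs_coord_le_norm[of x i] x by simp
      thus "norm (coord x i *\<^sub>R T (unit_vec i)) \<le> norm (T (unit_vec i))"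
        by (simp add: mult_left_le_one_le)
    qed
    finally show ?thesis .
  qed
  thus ?thesis using that[of "max 1 b"] T by force
qed

lemma inner_body_convex: "valid_rounding d s \<Longrightarrow> convex (inner_body s)"
proof -
  assume "valid_rounding d s"
  hence "convex ((\<lambda>x. center s + x) ` ((\<lambda>x. scaling s *\<^sub>R x) ` ellips s))"
    by (intro convex_translation convex_scaling) (auto simp: valid_rounding_def ellipsoid_convex)
  thus ?thesis by (simp add: inner_body_def image_image)
qed

lemma center_in_inner_body: "valid_rounding d s \<Longrightarrow> center s \<in> inner_body s"
  unfolding inner_body_def valid_rounding_def
  by (rule image_eqI[of _ _ 0]) (auto simp: ellipsoid_zero)

text \<open>The inner body is convex, so a single weight on \<open>z\<close> is enough. Subtracting
  the center gives the shape of the hypothesis \<open>inn\<close> of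
  \<open>rounding_step\<close>.\<close>

lemma hull_inner_body_pointE:
  assumes "valid_rounding d s" "y \<in> convex hull (inner_body s \<union> {z})"
  obtains l e where "0 \<le> l" "l \<le> 1" "e \<in> ellips s"
    "y - center s = ((1 - l) * scaling s) *\<^sub>R e + l *\<^sub>R (z - center s)"
proof -
  have ne: "inner_body s \<noteq> {}" using center_in_inner_body[OF assms(1)] by auto
  have cv: "convex hull (inner_body s) = inner_body s"
    using inner_body_convex[OF assms(1)] by (simp add: convex_hull_eq)
  have "y \<in> convex hull (insert z (inner_body s))" using assms(2) by simp
  then obtain u v b where uv: "0 \<le> u" "0 \<le> v" "u + v = 1" "b \<in> inner_body s"
      "y = u *\<^sub>R z + v *\<^sub>R b"
    unfolding convex_hull_insert[OF ne] cv by auto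
  obtain e where e: "e \<in> ellips s" "b = center s + scaling s *\<^sub>R e"
    using uv(4) by (auto simp: inner_body_def)
  have v: "v = 1 - u" using uv by simp
  show ?thesis
    by (rule that[of u e]) (use uv e v in \<open>auto simp: algebra_simps\<close>)
qed

section \<open>A single move of the adversary\<close>

text \<open>If \<open>y\<close> is the preimage of \<open>unit_vec j\<close>, then \<open>r\<close>
  is \<open>1 / norm y\<close>; it is below \<open>R\<close> because the preimage of the point at
  distance \<open>R\<close> has norm above 1.\<close>

lemma boundary_point:
  assumes "linear T" "bij_betw T (Rd d) (Rd d)" "j < d" "R > 0"
    "R *\<^sub>R unit_vec j \<notin> T ` unit_ball d"
  obtains r x where "0 < r" "r < R" "x \<in> Rd d" "norm x = 1" "T x = r *\<^sub>R unit_vec j"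
proof -
  obtain y where y: "y \<in> Rd d" "T y = unit_vec j"
    using assms(2,3) unit_vec_in_Rd by (metis bij_betw_iff_bijections)
  have "unit_vec j \<noteq> 0" using norm_unit_vec[of j] by force
  hence y0: "norm y > 0" using y linear_0[OF assms(1)] by auto
  have "T (R *\<^sub>R y) = R *\<^sub>R unit_vec j" using y by (simp add: linear_scale[OF assms(1)])
  hence "R *\<^sub>R y \<notin> unit_ball d" using assms(5) by force
  hence "R * norm y > 1"
    using y assms(4) subspace_Rd[of d] by (simp add: unit_ball_def subspace_scale)
  thus ?thesis
    using y y0 subspace_Rd[of d]
    by (intro that[of "1 / norm y" "y /\<^sub>R norm y"])
       (auto simp: field_simps linear_scale[OF assms(1)] subspace_scale)
qed

text \<open>Pulling back along \<open>T\<close> turns the old ellipsoid into the unit ball and the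
  new point into a vector of norm 2, so \<open>rounding_step\<close> applies. The radius
  \<open>r\<close> is fixed before \<open>s'\<close>, since the adversary moves before the algorithm
  answers.\<close>

lemma adversarial_step:
  assumes d: "d \<ge> 2" and s: "valid_rounding d s" and j: "j < d" and R: "R > 0"
    and out: "R *\<^sub>R unit_vec j \<notin> ellips s"
  obtains r where "0 < r" "r < R"
    "\<And>s'. valid_rounding d s' \<Longrightarrow>
      convex hull (outer_body s \<union> {center s + (2 * r) *\<^sub>R unit_vec j}) \<subseteq> outer_body s' \<Longrightarrow>
      inner_body s' \<subseteq> convex hull (inner_body s \<union> {center s + (2 * r) *\<^sub>R unit_vec j}) \<Longrightarrow>
      1/6 \<le> 1 / scaling s' - 1 / scaling s \<and>
      (\<forall>w i. (\<forall>x\<in>ellips s. coord x i \<le> w) \<longrightarrow> (\<forall>x\<in>ellips s'. coord x i \<le>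
        (if i = j then 23 * (1 / scaling s' - 1 / scaling s) * w
         else scaling s / scaling s' * w)))"
proof -
  obtain T where T: "linear T" "bij_betw T (Rd d) (Rd d)" "ellips s = T ` unit_ball d"
    using s by (auto simp: valid_rounding_def ellipsoid_def)
  obtain r \<zeta>1 where r: "0 < r" "r < R" "\<zeta>1 \<in> Rd d" "norm \<zeta>1 = 1" "T \<zeta>1 = r *\<^sub>R unit_vec j"
    using boundary_point[OF T(1,2) j R] out T(3) by metis
  define z where "z = center s + (2 * r) *\<^sub>R unit_vec j"
  define \<zeta> where "\<zeta> = 2 *\<^sub>R \<zeta>1"
  have \<zeta>: "\<zeta> \<in> Rd d" "norm \<zeta> = 2" "T \<zeta> = z - center s"
    using r subspace_Rd[of d] by (simp_all add: \<zeta>_def z_def linear_scale[OF T(1)] subspace_scale)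
  have inj: "x = y" if "x \<in> Rd d" "y \<in> Rd d" "T x = T y" for x y
    using that T(2) by (auto simp: bij_betw_def inj_on_def)
  show ?thesis
  proof (rule that[OF r(1,2)])
    fix s' assume s': "valid_rounding d s'"
      and "convex hull (outer_body s \<union> {center s + (2 * r) *\<^sub>R unit_vec j}) \<subseteq> outer_body s'"
      and "inner_body s' \<subseteq> convex hull (inner_body s \<union> {center s + (2 * r) *\<^sub>R unit_vec j})"
    hence outer: "outer_body s \<subseteq> outer_body s'" "z \<in> outer_body s'"
      and inn: "inner_body s' \<subseteq> convex hull (inner_body s \<union> {z})"
      using hull_subset[of "outer_body s \<union> {z}" convex] by (auto simp: z_def)
    define \<alpha> where "\<alpha> = scaling s"
    define \<beta> where "\<beta> = scaling s'"
    have ab: "0 < \<alpha>" "\<alpha> \<le> 1" "0 < \<beta>" using s s' by (auto simp: \<alpha>_def \<beta>_def valid_rounding_def)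
    have ctr: "center s \<in> Rd d" "center s' \<in> Rd d" using s s' by (auto simp: valid_rounding_def)
    obtain c where c: "c \<in> Rd d" "T c = center s' - center s"
      using T(2) ctr subspace_diff[OF subspace_Rd] by (metis bij_betw_iff_bijections)
    \<comment> \<open>The new ellipsoid in the coordinates where the old one is the unit
      ball.\<close>
    define K where "K = {k \<in> Rd d. T k \<in> ellips s'}"
    have ell': "ellipsoid d (ellips s')" using s' by (simp add: valid_rounding_def)
    have repr: "\<exists>l b. 0 \<le> l \<and> l \<le> 1 \<and> b \<in> unit_ball d \<and>
        c + \<beta> *\<^sub>R k = ((1 - l) * \<alpha>) *\<^sub>R b + l *\<^sub>R \<zeta>" if k: "k \<in> K" for k
    proof -
      have "center s' + \<beta> *\<^sub>R T k \<in> inner_body s'"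
        using k by (auto simp: inner_body_def K_def \<beta>_def)
      then obtain l e where le: "0 \<le> l" "l \<le> 1" "e \<in> ellips s"
        "center s' + \<beta> *\<^sub>R T k - center s = ((1 - l) * \<alpha>) *\<^sub>R e + l *\<^sub>R (z - center s)"
        using inn hull_inner_body_pointE[OF s, of _ z] unfolding \<alpha>_def by blast
      obtain b where b: "b \<in> unit_ball d" "e = T b" using le T by auto
      have "T (c + \<beta> *\<^sub>R k) = T (((1 - l) * \<alpha>) *\<^sub>R b + l *\<^sub>R \<zeta>)"
        using le(4) unfolding linear_add[OF T(1)] linear_scale[OF T(1)] b(2) c(2) \<zeta>(3)
        by (simp add: algebra_simps)
      hence "c + \<beta> *\<^sub>R k = ((1 - l) * \<alpha>) *\<^sub>R b + l *\<^sub>R \<zeta>"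
        by (rule inj[rotated 2])
           (use k b(1) c(1) \<zeta>(1) subspace_Rd[of d] in
             \<open>simp_all add: K_def unit_ball_def subspace_add subspace_scale\<close>)
      thus ?thesis using le b by blast
    qed
    have K0: "0 \<in> K" using ellipsoid_zero[OF ell'] linear_0[OF T(1)] subspace_0[OF subspace_Rd]
      by (simp add: K_def)
    have symK: "- k \<in> K" if "k \<in> K" for k
      using that ellipsoid_symmetric[OF ell'] subspace_neg[OF subspace_Rd]
      by (auto simp: K_def linear_neg[OF T(1)])
    have outK: "b - c \<in> K" if b: "b \<in> Rd d" "center s + T b \<in> outer_body s'" for b
    proof -
      obtain e where e: "e \<in> ellips s'" "center s + T b = center s' + e"
        using b(2) by (auto simp: outer_body_def)
      have "T (b - c) = e" using e(2) unfolding linear_diff[OF T(1)] c(2) by (simp add: algebra_simps)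
      thus ?thesis using e(1) b(1) c(1) subspace_diff[OF subspace_Rd] by (simp add: K_def)
    qed
    have outb: "b - c \<in> K" if "b \<in> Rd d" "norm b \<le> 1" for b
    proof (rule outK[OF that(1)])
      have "center s + T b \<in> outer_body s"
        unfolding outer_body_def T(3) using that by (auto simp: unit_ball_def)
      thus "center s + T b \<in> outer_body s'" using outer by blast
    qed
    have outz: "\<zeta> - c \<in> K" using outer(2) \<zeta> by (intro outK) auto
    obtain w where w: "w \<in> Rd d" "norm w = 1" "inner w \<zeta> = 0"
      using Rd_orthogonal_unit_vector[OF d \<zeta>(1)] by blast
    have repr': "\<exists>l b. 0 \<le> l \<and> l \<le> 1 \<and> norm b \<le> 1 \<and>
        c + \<beta> *\<^sub>R k = ((1 - l) * \<alpha>) *\<^sub>R b + l *\<^sub>R \<zeta>" if "k \<in> K" for k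
      using repr[OF that] by (auto simp: unit_ball_def)
    note st = rounding_step[OF subspace_Rd \<zeta>(1,2) w ab symK outb outz repr']
    define D where "D = 1/\<beta> - 1/\<alpha>"
    have st1: "\<beta> \<le> \<alpha>" by (rule st(1))
    have st2: "1/6 \<le> D" unfolding D_def by (rule st(2))
    have coord_bound: "coord x i \<le>
        (if i = j then 23 * D * w else \<alpha> / \<beta> * w)"
      if w: "\<forall>x\<in>ellips s. coord x i \<le> w" and x: "x \<in> ellips s'" for w i x
    proof -
      \<comment> \<open>By symmetry of the ellipsoid a one-sided bound is a bound on the
        half-width.\<close>
      have w': "\<bar>coord e i\<bar> \<le> w" if "e \<in> ellips s" for e
        using w that ellipsoid_symmetric[of d "ellips s" e] s
        by (force simp: valid_rounding_def coord_simps abs_le_iff)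
      have w0: "w \<ge> 0" using w'[OF ellipsoid_zero[of d]] s by (auto simp: valid_rounding_def coord_simps)
      have "- x \<in> ellips s'" using x ellipsoid_symmetric[OF ell'] by blast
      hence "center s' + \<beta> *\<^sub>R (- x) \<in> inner_body s'"
        unfolding inner_body_def \<beta>_def by (rule imageI)
      then obtain l e where le: "0 \<le> l" "l \<le> 1" "e \<in> ellips s"
        "center s' + \<beta> *\<^sub>R (- x) - center s = ((1 - l) * \<alpha>) *\<^sub>R e + l *\<^sub>R (z - center s)"
        using inn hull_inner_body_pointE[OF s, of _ z] unfolding \<alpha>_def by blast
      have zc: "z - center s = (2 * r) *\<^sub>R unit_vec j" by (simp add: z_def)
      have low: "- (\<alpha> * w) \<le> ((1 - l) * \<alpha>) * coord e i"
        and up: "((1 - l) * \<alpha>) * coord e i \<le> \<alpha> * w" if "e \<in> ellips s" "0 \<le> l" "l \<le> 1" for e l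
      proof -
        have "\<bar>((1 - l) * \<alpha>) * coord e i\<bar> \<le> (1 * \<alpha>) * w"
          using that w' ab w0 unfolding abs_mult by (intro mult_mono) auto
        thus "- (\<alpha> * w) \<le> ((1 - l) * \<alpha>) * coord e i" "((1 - l) * \<alpha>) * coord e i \<le> \<alpha> * w"
          by simp_all
      qed
      show ?thesis
      proof (cases "i = j")
        \<comment> \<open>The played point has no component along \<open>i\<close> relative to the
          old center, so both ends of the new inner body stay within \<open>\<alpha> * w\<close>;
          subtracting them removes the center.\<close>
        case False
        have "x \<in> ellips s'" by fact
        hence "center s' + \<beta> *\<^sub>R x \<in> inner_body s'" by (auto simp: inner_body_def \<beta>_def)
        then obtain l' e' where le': "0 \<le> l'" "l' \<le> 1" "e' \<in> ellips s"
          "center s' + \<beta> *\<^sub>R x - center s = ((1 - l') * \<alpha>) *\<^sub>R e' + l' *\<^sub>R (z - center s)"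
          using inn hull_inner_body_pointE[OF s, of _ z] unfolding \<alpha>_def by blast
        have "coord (center s') i - coord (center s) i + \<beta> * coord x i = (1 - l') * \<alpha> * coord e' i"
          using arg_cong[OF le'(4), of "\<lambda>y. coord y i"] False unfolding zc by (simp add: coord_simps)
        moreover have "coord (center s') i - coord (center s) i - \<beta> * coord x i = (1 - l) * \<alpha> * coord e i"
          using arg_cong[OF le(4), of "\<lambda>y. coord y i"] False unfolding zc by (simp add: coord_simps)
        ultimately have "\<beta> * coord x i \<le> \<alpha> * w"
          using low[OF le(3,1,2)] up[OF le'(3,1,2)] by linarith
        thus ?thesis using False ab by (simp add: field_simps)
      next
        case True
        \<comment> \<open>\<open>repr\<close> at \<open>0\<close> describes the center shift, with
          weight \<open>m\<close> on \<open>\<zeta>\<close>. The lower end of the inner body stays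
          above \<open>- (\<alpha> * w)\<close>, so \<open>\<beta>\<close> times the half-width is
          at most the shift plus \<open>\<alpha> * w\<close>.\<close>
        obtain m b where mb: "0 \<le> m" "m \<le> 1" "b \<in> unit_ball d"
          "c = ((1 - m) * \<alpha>) *\<^sub>R b + m *\<^sub>R \<zeta>"
          using repr[OF K0] by auto
        have "norm b \<le> 1" using mb by (simp add: unit_ball_def)
        hence mD: "m/\<beta> - (\<alpha>/\<beta>)/2 \<le> D" unfolding D_def using st(3) mb by blast
        have Tb: "T b \<in> ellips s" using mb T by auto
        have rw: "r \<le> w"
        proof -
          have "\<zeta>1 \<in> unit_ball d" using r by (simp add: unit_ball_def)
          hence "r *\<^sub>R unit_vec j \<in> ellips s"
            unfolding T(3) r(5)[symmetric] by (rule imageI)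
          from w'[OF this] show ?thesis using True r by (simp add: coord_simps)
        qed
        have "center s' - center s = ((1 - m) * \<alpha>) *\<^sub>R T b + (m * (2 * r)) *\<^sub>R unit_vec j"
          unfolding c(2)[symmetric]
          by (subst mb(4)) (simp add: linear_add[OF T(1)] linear_scale[OF T(1)] \<zeta>(3) zc)
        from arg_cong[OF this, of "\<lambda>y. coord y i"]
        have "coord (center s') i - coord (center s) i = (1 - m) * \<alpha> * coord (T b) i + m * (2 * r)"
          using True by (simp add: coord_simps)
        moreover have "coord (center s') i - coord (center s) i - \<beta> * coord x i
            = (1 - l) * \<alpha> * coord e i + l * (2 * r)"
          using arg_cong[OF le(4), of "\<lambda>y. coord y i"] True unfolding zc by (simp add: coord_simps)
        moreover have "m * (2 * r) \<le> m * (2 * w)" using rw mb by (intro mult_left_mono) auto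
        moreover have "0 \<le> l * (2 * r)" using le r by simp
        ultimately have "\<beta> * coord x i \<le> (2 * \<alpha> + 2 * m) * w"
          using low[OF le(3,1,2)] up[OF Tb mb(1,2)] by (simp add: algebra_simps)
        hence "coord x i \<le> (2 * (\<alpha>/\<beta>) + 2 * (m/\<beta>)) * w"
          using ab by (simp add: field_simps)
        also have "\<dots> \<le> (23 * D) * w"
        proof (rule mult_right_mono[OF _ w0])
          have "D - (\<alpha>/\<beta> - 1) = (\<alpha> - \<beta>) * (1 - \<alpha>) / (\<alpha> * \<beta>)"
            using ab by (simp add: D_def field_simps)
          also have "\<dots> \<ge> 0" using st1 ab by simp
          finally have "\<alpha>/\<beta> - 1 \<le> D" by simp
          \<comment> \<open>The sum is at most \<open>3 * p + 2 * D\<close>, hence at most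
            \<open>5 * D + 3\<close>, and \<open>3 \<le> 18 * D\<close>.\<close>
          moreover have "2 * p + 2 * q \<le> 23 * D" if "p - 1 \<le> D" "q - p/2 \<le> D" for p q
            using that st2 by linarith
          ultimately show "2 * (\<alpha>/\<beta>) + 2 * (m/\<beta>) \<le> 23 * D" using mD by blast
        qed
        finally show ?thesis using True by simp
      qed
    qed
    show "1/6 \<le> 1 / scaling s' - 1 / scaling s \<and>
      (\<forall>w i. (\<forall>x\<in>ellips s. coord x i \<le> w) \<longrightarrow> (\<forall>x\<in>ellips s'. coord x i \<le>
        (if i = j then 23 * (1 / scaling s' - 1 / scaling s) * w
         else scaling s / scaling s' * w)))"
      using st2 coord_bound unfolding D_def \<alpha>_def \<beta>_def by blast
  qed
qed

section \<open>Bounds on hulls and the game of the adversary\<close>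

lemma abs_coord_convex_hull_le:
  assumes "x \<in> convex hull S" "\<And>z. z \<in> S \<Longrightarrow> \<bar>coord z i\<bar> \<le> L"
  shows "\<bar>coord x i\<bar> \<le> L"
proof -
  have "convex ((\<lambda>x. coord x i) -` {- L..L})"
    by (intro convex_linear_vimage linear_coord convex_real_interval)
  moreover have "S \<subseteq> (\<lambda>x. coord x i) -` {- L..L}"
    using assms(2) by (force simp: abs_le_iff)
  ultimately have "convex hull S \<subseteq> (\<lambda>x. coord x i) -` {- L..L}" by (rule hull_minimal[rotated])
  thus ?thesis using assms(1) by (auto simp: abs_le_iff)
qed

lemma norm_convex_hull_le:
  fixes x :: "'a::real_normed_vector"
  assumes "x \<in> convex hull S" "\<And>z. z \<in> S \<Longrightarrow> norm z \<le> M"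
  shows "norm x \<le> M"
  using hull_minimal[of S "cball 0 M" convex] assms by (auto simp: subset_iff)

text \<open>\<open>zs0\<close> is the opening stream, \<open>P\<close> and \<open>L\<close> bound
  its norms and last coordinates, \<open>b\<close> bounds the ellipsoid that answers it, and
  \<open>R\<close> is the radius aimed at on the axes below \<open>d - 1\<close>.\<close>

locale adversary =
  fixes d :: nat and A :: algorithm and s :: rounding and zs0 :: "fseq list" and L P b R :: real
  assumes d: "d \<ge> 2"
    and streaming: "streaming_algorithm d A"
    and monotone: "monotone_algorithm d A"
    and solves: "solves_rounding d A"
    and valid: "valid_rounding d s"
    and admissible_init: "admissible_stream d s zs0"
    and norm_init: "\<And>z. z \<in> set zs0 \<Longrightarrow> norm z \<le> P"
    and width_init: "\<And>z. z \<in> set zs0 \<Longrightarrow> \<bar>coord z (d - 1)\<bar> \<le> L"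
    and b: "b \<ge> 1" "\<And>x. x \<in> ellips (A s zs0) \<Longrightarrow> norm x \<le> b"
    and R: "R > 0"
begin

definition stretch :: "fseq list \<Rightarrow> real"
  where "stretch zs = 1 / scaling (A s zs)"

text \<open>The invariant after \<open>n\<close> moves. Half-width bounds \<open>w\<close> are
  carried as witnesses instead of suprema. The term \<open>23 * stretch zs\<close> pays for the
  growth of played axes, the last term for the growth of the others; both telescope over the
  moves.\<close>

definition reached :: "nat \<Rightarrow> fseq list \<Rightarrow> bool"
  where "reached n zs \<longleftrightarrow> admissible_stream d s zs \<and> set zs0 \<subseteq> set zs \<and>
    (\<forall>z\<in>set zs. norm z \<le> P + real n * (2 * R) \<and> \<bar>coord z (d - 1)\<bar> \<le> L) \<and>
    real n / 6 \<le> stretch zs \<and>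
    (\<exists>w. (\<forall>i. w i > 0) \<and> (\<forall>i. \<forall>x\<in>ellips (A s zs). coord x i \<le> w i) \<and>
      (\<Sum>i<d-1. ln (w i)) \<le> real d * ln b + 23 * stretch zs + real d * ln (stretch zs))"

lemma valid_output: "set zs \<subseteq> Rd d \<Longrightarrow> valid_rounding d (A s zs)"
  using streaming valid by (auto simp: streaming_algorithm_def)

lemma stretch_ge_1: "set zs \<subseteq> Rd d \<Longrightarrow> stretch zs \<ge> 1"
  using valid_output[of zs] by (simp add: stretch_def valid_rounding_def)

lemma reached_0: "reached 0 zs0"
proof -
  have sub: "set zs0 \<subseteq> Rd d" using admissible_init by (simp add: admissible_stream_def)
  note st = stretch_ge_1[OF sub]
  have "(\<Sum>i<d-1. ln b) \<le> real d * ln b"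
    using b(1) d by (simp add: mult_right_mono)
  also have "\<dots> \<le> real d * ln b + 23 * stretch zs0 + real d * ln (stretch zs0)"
    using st by simp
  finally have "(\<Sum>i<d-1. ln b) \<le> real d * ln b + 23 * stretch zs0 + real d * ln (stretch zs0)" .
  moreover have "coord x i \<le> b" if "x \<in> ellips (A s zs0)" for x i
    using b(2)[OF that] abs_coord_le_norm[of x i] by simp
  ultimately have "\<exists>w. (\<forall>i. w i > 0) \<and> (\<forall>i. \<forall>x\<in>ellips (A s zs0). coord x i \<le> w i) \<and>
      (\<Sum>i<d-1. ln (w i)) \<le> real d * ln b + 23 * stretch zs0 + real d * ln (stretch zs0)"
    using b(1) by (intro exI[of _ "\<lambda>_. b"]) auto
  thus ?thesis
    using admissible_init norm_init width_init st by (simp add: reached_def)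
qed

text \<open>The new point differs from a center in the hull of the stream by less than
  \<open>2 * R\<close> on an axis other than the last, which preserves the size bounds. The
  potential grows by \<open>ln q\<close> per axis and by \<open>23 * D\<close> on axis
  \<open>j\<close>.\<close>

lemma reached_Suc:
  assumes "reached n zs" and j: "j < d - 1" "R *\<^sub>R unit_vec j \<notin> ellips (A s zs)"
  shows "\<exists>z. reached (Suc n) (zs @ [z])"
proof -
  from assms(1) have adm: "admissible_stream d s zs" and sub0: "set zs0 \<subseteq> set zs"
    and bd: "\<And>z. z \<in> set zs \<Longrightarrow> norm z \<le> P + real n * (2 * R)"
    and wd: "\<And>z. z \<in> set zs \<Longrightarrow> \<bar>coord z (d - 1)\<bar> \<le> L"
    and n: "real n / 6 \<le> stretch zs"
    by (auto simp: reached_def)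
  obtain w where w: "\<And>i. w i > 0" "\<And>i x. x \<in> ellips (A s zs) \<Longrightarrow> coord x i \<le> w i"
    "(\<Sum>i<d-1. ln (w i)) \<le> real d * ln b + 23 * stretch zs + real d * ln (stretch zs)"
    using assms(1) unfolding reached_def by blast
  have sub: "set zs \<subseteq> Rd d" using adm by (simp add: admissible_stream_def)
  note val = valid_output[OF sub]
  have jd: "j < d" using j by simp
  obtain r where r: "0 < r" "r < R"
    and step: "\<And>s'. valid_rounding d s' \<Longrightarrow>
      convex hull (outer_body (A s zs) \<union> {center (A s zs) + (2 * r) *\<^sub>R unit_vec j}) \<subseteq> outer_body s' \<Longrightarrow>
      inner_body s' \<subseteq> convex hull (inner_body (A s zs) \<union> {center (A s zs) + (2 * r) *\<^sub>R unit_vec j}) \<Longrightarrow>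
      1/6 \<le> 1 / scaling s' - 1 / scaling (A s zs) \<and>
      (\<forall>w i. (\<forall>x\<in>ellips (A s zs). coord x i \<le> w) \<longrightarrow> (\<forall>x\<in>ellips s'. coord x i \<le>
        (if i = j then 23 * (1 / scaling s' - 1 / scaling (A s zs)) * w
         else scaling (A s zs) / scaling s' * w)))"
    using adversarial_step[OF d val jd R j(2)] by blast
  define c where "c = center (A s zs)"
  define z where "z = c + (2 * r) *\<^sub>R unit_vec j"
  have "inner_body (A s zs) \<subseteq> convex hull (set zs)"
    using solves valid adm by (auto simp: solves_rounding_def)
  hence c: "c \<in> convex hull (set zs)" using center_in_inner_body[OF val] by (auto simp: c_def)
  have cR: "c \<in> Rd d" using val by (simp add: c_def valid_rounding_def)
  have zR: "z \<in> Rd d"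
    using cR jd subspace_Rd[of d] by (simp add: z_def subspace_add subspace_scale)
  have sub': "set (zs @ [z]) \<subseteq> Rd d" using sub zR by simp
  note val' = valid_output[OF sub']
  have "norm z \<le> norm c + norm ((2 * r) *\<^sub>R unit_vec j)"
    unfolding z_def by (rule norm_triangle_ineq)
  also have "\<dots> \<le> P + real (Suc n) * (2 * R)"
    using norm_convex_hull_le[OF c bd] r by (simp add: algebra_simps)
  finally have nz: "norm z \<le> P + real (Suc n) * (2 * R)" .
  have wz: "\<bar>coord z (d - 1)\<bar> \<le> L"
    using abs_coord_convex_hull_le[OF c wd] j by (simp add: z_def coord_simps)
  have mono: "convex hull (outer_body (A s zs) \<union> {z}) \<subseteq> outer_body (A s (zs @ [z]))"
    "inner_body (A s (zs @ [z])) \<subseteq> convex hull (inner_body (A s zs) \<union> {z})"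
    using monotone valid sub zR by (auto simp: monotone_algorithm_def)
  define D where "D = stretch (zs @ [z]) - stretch zs"
  define q where "q = stretch (zs @ [z]) / stretch zs"
  have st: "stretch zs \<ge> 1" "stretch (zs @ [z]) \<ge> 1"
    using stretch_ge_1[OF sub] stretch_ge_1[OF sub'] by auto
  note step' = step[folded c_def, folded z_def, OF val' mono]
  have D: "1/6 \<le> D" using step' by (simp add: D_def stretch_def)
  have q: "q \<ge> 1" using D st by (simp add: q_def D_def)
  have qs: "scaling (A s zs) / scaling (A s (zs @ [z])) = q" by (simp add: q_def stretch_def)
  have Ds: "1 / scaling (A s (zs @ [z])) - 1 / scaling (A s zs) = D" by (simp add: D_def stretch_def)
  define w' where "w' = (\<lambda>i. if i = j then 23 * D * w i else q * w i)"
  have "D > 0" using D by linarith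
  hence w'1: "w' i > 0" for i using q w(1)[of i] w(1)[of j] by (simp add: w'_def)
  have w'2: "coord x i \<le> w' i" if "x \<in> ellips (A s (zs @ [z]))" for x i
    using step' w(2) that unfolding qs Ds w'_def by simp
  have "(\<Sum>i<d-1. ln (w' i)) \<le> (\<Sum>i<d-1. (ln (w i) + ln q) + (if i = j then 23 * D else 0))"
  proof (rule sum_mono)
    fix i
    \<comment> \<open>A logarithm is below its argument; the nonnegative \<open>ln q\<close> is
      added so that all axes have the same summand.\<close>
    have "ln (23 * D) \<le> ln q + 23 * D"
      using D q ln_le_minus_one[of "23 * D"] ln_ge_zero[of q] by linarith
    thus "ln (w' i) \<le> (ln (w i) + ln q) + (if i = j then 23 * D else 0)"
      using \<open>D > 0\<close> q w(1)[of i] by (auto simp: w'_def ln_mult)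
  qed
  also have "\<dots> = (\<Sum>i<d-1. ln (w i)) + real (d - 1) * ln q + 23 * D"
    using j(1) by (simp add: sum.distrib)
  also have "\<dots> \<le> (\<Sum>i<d-1. ln (w i)) + real d * ln q + 23 * D"
    using q \<open>D > 0\<close> by (intro add_mono mult_right_mono) auto
  \<comment> \<open>Both \<open>D\<close> and \<open>ln q\<close> are differences of consecutive
    values, so the old terms cancel.\<close>
  also have "\<dots> \<le> real d * ln b + 23 * stretch (zs @ [z]) + real d * ln (stretch (zs @ [z]))"
    using w(3) st by (simp add: q_def D_def ln_div algebra_simps)
  finally have w'3: "(\<Sum>i<d-1. ln (w' i)) \<le> \<dots>" .
  have "admissible_stream d s (zs @ [z])"
    using adm zR hull_mono[of "set zs" "set (zs @ [z])" convex]
    by (auto simp: admissible_stream_def)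
  moreover have "real (Suc n) / 6 \<le> stretch (zs @ [z])"
    using n D by (simp add: D_def)
  moreover have "norm y \<le> P + real (Suc n) * (2 * R)" if "y \<in> set zs" for y
    using bd[OF that] R by (simp add: algebra_simps)
  ultimately have "reached (Suc n) (zs @ [z])"
    unfolding reached_def using sub0 nz wz wd w'1 w'2 w'3
    by (intro conjI exI[of _ w']) auto
  thus ?thesis ..
qed

text \<open>Every move raises \<open>stretch\<close> by at least \<open>1/6\<close>, so after about
  \<open>6 * M\<close> moves either \<open>M\<close> is reached or every axis below
  \<open>d - 1\<close> already has radius \<open>R\<close>.\<close>

lemma game_ends:
  assumes M: "M \<ge> 0"
  obtains n zs where "reached n zs" "real n \<le> 6 * M + 1"
    "M \<le> stretch zs \<or>
     real (d - 1) * ln R \<le> real d * ln b + 23 * stretch zs + real d * ln (stretch zs)"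
proof -
  define final where "final = (\<lambda>zs. M \<le> stretch zs \<or> (\<forall>j<d-1. R *\<^sub>R unit_vec j \<in> ellips (A s zs)))"
  have ind: "(\<exists>zs. reached n zs \<and> real n \<le> 6 * M + 1) \<or>
      (\<exists>n zs. reached n zs \<and> real n \<le> 6 * M + 1 \<and> final zs)" for n
  proof (induction n)
    case 0
    show ?case using reached_0 M by auto
  next
    case (Suc n)
    show ?case
    proof (cases "\<exists>zs. reached n zs \<and> real n \<le> 6 * M + 1 \<and> \<not> final zs")
      case True
      then obtain zs where zs: "reached n zs" "\<not> final zs" by blast
      have "real n / 6 \<le> stretch zs" using zs by (simp add: reached_def)
      \<comment> \<open>A position that is not final has \<open>n < 6 * M\<close>, hence the extra 1
        in the bound.\<close>
      hence "real (Suc n) \<le> 6 * M + 1" using zs(2) by (simp add: final_def)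
      thus ?thesis using zs reached_Suc[OF zs(1)] unfolding final_def by blast
    next
      case False
      thus ?thesis using Suc.IH by blast
    qed
  qed
  \<comment> \<open>At a step count beyond \<open>6 * M + 1\<close> the first alternative of
    \<open>ind\<close> is impossible, so a final position has occurred.\<close>
  define N where "N = Suc (nat \<lceil>6 * M + 1\<rceil>)"
  have "\<not> real N \<le> 6 * M + 1" unfolding N_def by linarith
  then obtain n zs where zs: "reached n zs" "real n \<le> 6 * M + 1" "final zs"
    using ind[of N] by blast
  obtain w where w: "\<And>i. w i > 0" "\<And>i x. x \<in> ellips (A s zs) \<Longrightarrow> coord x i \<le> w i"
    "(\<Sum>i<d-1. ln (w i)) \<le> real d * ln b + 23 * stretch zs + real d * ln (stretch zs)"
    using zs(1) unfolding reached_def by blast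
  show ?thesis
  proof (rule that[OF zs(1,2)], cases "M \<le> stretch zs")
    case False
    hence e: "\<And>j. j < d - 1 \<Longrightarrow> R *\<^sub>R unit_vec j \<in> ellips (A s zs)"
      using zs(3) by (simp add: final_def)
    have "R \<le> w j" if "j < d - 1" for j using w(2)[OF e[OF that], of j] by (simp add: coord_simps)
    hence "(\<Sum>i<d-1. ln R) \<le> (\<Sum>i<d-1. ln (w i))"
      using R w(1) by (intro sum_mono ln_mono) auto
    thus "M \<le> stretch zs \<or>
        real (d - 1) * ln R \<le> real d * ln b + 23 * stretch zs + real d * ln (stretch zs)"
      using w(3) by simp
  qed simp
qed

end

section \<open>Estimates for the circumradius and the inradius\<close>

text \<open>A ball around the origin gives the upper bound; a ball that contains two points at
  distance \<open>2 * norm v\<close> gives the lower one.\<close>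

lemma circumradius_bounds:
  assumes M: "M > 0" and K: "K \<subseteq> Rd d" "\<And>x. x \<in> K \<Longrightarrow> norm x \<le> M"
    and v: "v \<in> K" "- v \<in> K"
  shows "norm v \<le> circumradius d K" "circumradius d K \<le> M"
proof -
  let ?S = "{R. 0 \<le> R \<and> (\<exists>c\<in>Rd d. K \<subseteq> (\<lambda>x. c + R *\<^sub>R x) ` unit_ball d)}"
  have "K \<subseteq> (\<lambda>x. 0 + M *\<^sub>R x) ` unit_ball d"
  proof
    fix x assume "x \<in> K"
    thus "x \<in> (\<lambda>x. 0 + M *\<^sub>R x) ` unit_ball d"
      using M K subspace_Rd[of d]
      by (intro image_eqI[of _ _ "x /\<^sub>R M"])
         (auto simp: unit_ball_def field_simps subset_iff subspace_scale)
  qed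
  moreover have "0 \<in> Rd d" by (rule subspace_0[OF subspace_Rd])
  ultimately have MS: "M \<in> ?S" using M by (intro CollectI conjI bexI[of _ 0]) auto
  show "circumradius d K \<le> M" unfolding circumradius_def
    by (rule cInf_lower[OF MS]) (auto intro: bdd_belowI[of _ 0])
  have "norm v \<le> R" if R: "R \<in> ?S" for R
  proof -
    obtain c where R0: "0 \<le> R" and c: "K \<subseteq> (\<lambda>x. c + R *\<^sub>R x) ` unit_ball d"
      using R by blast
    obtain x y where xy: "x \<in> unit_ball d" "y \<in> unit_ball d"
      and v': "v = c + R *\<^sub>R x" "- v = c + R *\<^sub>R y"
      using c v by blast
    have "norm (x - y) \<le> 2"
      using norm_triangle_ineq4[of x y] xy by (auto simp: unit_ball_def)
    have "2 *\<^sub>R v = v - (- v)" by (simp add: scaleR_2)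
    also have "\<dots> = R *\<^sub>R (x - y)" unfolding v'(2) by (subst v'(1)) (simp add: algebra_simps)
    finally have "2 * norm v = R * norm (x - y)"
      using R0 by (metis abs_numeral abs_of_nonneg norm_scaleR)
    also have "\<dots> \<le> R * 2" using R0 \<open>norm (x - y) \<le> 2\<close> by (intro mult_left_mono)
    finally show "norm v \<le> R" by simp
  qed
  thus "norm v \<le> circumradius d K" unfolding circumradius_def
    using MS by (intro cInf_greatest) auto
qed

text \<open>The difference of the two points on axis \<open>i\<close> does not involve
  \<open>c\<close>, so \<open>unit_vec i\<close> lies in the span for every center. The inscribed
  ball therefore extends along that axis and must fit into a slab of half-width
  \<open>L\<close>.\<close>

lemma inradius_bounds:
  assumes i: "i < d" and L: "L > 0"
    and KL: "\<And>x. x \<in> K \<Longrightarrow> \<bar>coord x i\<bar> \<le> L"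
    and v: "L *\<^sub>R unit_vec i \<in> K" "- (L *\<^sub>R unit_vec i) \<in> K"
    and B: "unit_ball d \<subseteq> K"
  shows "1 \<le> inradius d K" "inradius d K \<le> L"
proof -
  let ?S = "{r. 0 \<le> r \<and> (\<exists>c\<in>Rd d. (\<lambda>x. c + r *\<^sub>R x) ` (unit_ball d \<inter> span ((\<lambda>y. y - c) ` K)) \<subseteq> K)}"
  have le: "r \<le> L" if r: "r \<in> ?S" for r
  proof -
    obtain c where c: "0 \<le> r" "(\<lambda>x. c + r *\<^sub>R x) ` (unit_ball d \<inter> span ((\<lambda>y. y - c) ` K)) \<subseteq> K"
      using r by blast
    let ?V = "span ((\<lambda>y. y - c) ` K)"
    have "L *\<^sub>R unit_vec i - c \<in> ?V" "- (L *\<^sub>R unit_vec i) - c \<in> ?V"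
      using v by (auto intro: span_base)
    hence "(L *\<^sub>R unit_vec i - c) - (- (L *\<^sub>R unit_vec i) - c) \<in> ?V" by (rule span_diff)
    hence "(1 / (2 * L)) *\<^sub>R ((L *\<^sub>R unit_vec i - c) - (- (L *\<^sub>R unit_vec i) - c)) \<in> ?V"
      by (rule span_scale)
    moreover have "(1 / (2 * L)) *\<^sub>R ((L *\<^sub>R unit_vec i - c) - (- (L *\<^sub>R unit_vec i) - c)) = unit_vec i"
      using L by (intro fseq_eqI) (simp add: coord_simps)
    ultimately have uV: "unit_vec i \<in> ?V" by simp
    have ub: "unit_vec i \<in> unit_ball d" using i by (simp add: unit_ball_def)
    have "c + r *\<^sub>R unit_vec i \<in> K" using c(2) uV ub by blast
    from KL[OF this] have 1: "\<bar>coord c i + r\<bar> \<le> L" by (simp add: coord_simps)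
    have "c + r *\<^sub>R (- unit_vec i) \<in> K"
      using c(2) span_neg[OF uV] neg_in_unit_ball[OF ub] by blast
    from KL[OF this] have "\<bar>coord c i - r\<bar> \<le> L" by (simp add: coord_simps)
    thus ?thesis using 1 by linarith
  qed
  have "1 \<in> ?S" using B subspace_0[OF subspace_Rd[of d]] by (auto intro!: bexI[of _ 0])
  thus "1 \<le> inradius d K" unfolding inradius_def
    by (rule cSup_upper) (rule bdd_aboveI[of _ L], rule le)
  show "inradius d K \<le> L" unfolding inradius_def
    by (rule cSup_least) (use \<open>1 \<in> ?S\<close> le in \<open>blast+\<close>)
qed

section \<open>The opening cross-polytope and the choice of the radius\<close>

text \<open>\<open>x\<close> is the average of the \<open>d\<close> points
  \<open>(real d * coord x i) *\<^sub>R unit_vec i\<close>, each on a segment between opposite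
  vertices.\<close>

lemma ball_subset_cross_polytope:
  assumes d: "d > 0" and r: "r > 0"
    and l: "\<And>i. i < d \<Longrightarrow> real d * r \<le> l i"
    and S: "\<And>i. i < d \<Longrightarrow> l i *\<^sub>R unit_vec i \<in> S" "\<And>i. i < d \<Longrightarrow> - (l i *\<^sub>R unit_vec i) \<in> S"
    and x: "x \<in> Rd d" "norm x \<le> r"
  shows "x \<in> convex hull S"
proof -
  have pt: "(real d * coord x i) *\<^sub>R unit_vec i \<in> convex hull S" if i: "i < d" for i
  proof -
    have li: "l i > 0" using l[OF i] d r by (smt (verit) mult_pos_pos of_nat_0_less_iff)
    define t where "t = real d * coord x i / l i"
    have "\<bar>real d * coord x i\<bar> \<le> real d * r"
      using abs_coord_le_norm[of x i] x(2) by (simp add: abs_mult mult_left_mono)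
    also have "\<dots> \<le> l i" by (rule l[OF i])
    finally have t: "\<bar>t\<bar> \<le> 1" using li by (simp add: t_def abs_mult)
    have "((1 + t)/2) *\<^sub>R (l i *\<^sub>R unit_vec i) + ((1 - t)/2) *\<^sub>R (- (l i *\<^sub>R unit_vec i)) \<in> convex hull S"
      using t S[OF i] by (intro convexD[OF convex_convex_hull] hull_inc) (auto simp: field_simps)
    moreover have "((1 + t)/2) *\<^sub>R (l i *\<^sub>R unit_vec i) + ((1 - t)/2) *\<^sub>R (- (l i *\<^sub>R unit_vec i))
        = (real d * coord x i) *\<^sub>R unit_vec i"
      using li by (intro fseq_eqI) (simp add: coord_simps t_def field_simps)
    ultimately show ?thesis by simp
  qed
  have "(\<Sum>i<d. (1 / real d) *\<^sub>R ((real d * coord x i) *\<^sub>R unit_vec i)) \<in> convex hull S"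
    using d pt by (intro convex_sum convex_convex_hull) auto
  also have "(\<Sum>i<d. (1 / real d) *\<^sub>R ((real d * coord x i) *\<^sub>R unit_vec i)) = x"
    using d by (subst (2) Rd_expansion[OF x(1)]) simp
  finally show ?thesis .
qed

text \<open>The first inequality excludes that the moves run out before \<open>stretch\<close> is
  large; the second keeps the stream in a ball of radius \<open>R\<^sup>2\<close>.\<close>

lemma large_radius_exists:
  fixes \<delta> k P :: real
  assumes "\<delta> > 0" "P > 0"
  shows "\<exists>R>1. k + \<delta> * ln (\<delta> * ln R / 100) < \<delta> * ln R / 4 \<and>
    P + (6 * (\<delta> * ln R / 100) + 1) * (2 * R) \<le> R\<^sup>2"
proof -
  have "\<forall>\<^sub>F R in at_top. k + \<delta> * ln (\<delta> * ln R / 100) < \<delta> * ln R / 4"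
    using assms by real_asymp
  moreover have "\<forall>\<^sub>F R in at_top. P + (6 * (\<delta> * ln R / 100) + 1) * (2 * R) \<le> R\<^sup>2"
    using assms by real_asymp
  moreover have "\<forall>\<^sub>F R in at_top. R > (1::real)" by real_asymp
  ultimately have "\<forall>\<^sub>F R in at_top. R > 1 \<and> k + \<delta> * ln (\<delta> * ln R / 100) < \<delta> * ln R / 4 \<and>
    P + (6 * (\<delta> * ln R / 100) + 1) * (2 * R) \<le> R\<^sup>2"
    by eventually_elim auto
  thus ?thesis by (rule eventually_happens'[rotated]) simp
qed

section \<open>Assembly of the lower bound\<close>

text \<open>The bound says little when the logarithm of the aspect ratio is small, so the stream
  must also exceed any prescribed \<open>\<kappa>\<^sub>0\<close>.\<close>

theorem theorem5:
  shows "\<exists>C::real. C > 0 \<and>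
    (\<forall>(d::nat) (A::algorithm) (s::rounding) (\<kappa>\<^sub>0::real).
      d \<ge> 2 \<longrightarrow> streaming_algorithm d A \<longrightarrow> monotone_algorithm d A \<longrightarrow> solves_rounding d A \<longrightarrow>
      valid_rounding d s \<longrightarrow>
      (\<exists>zs. admissible_stream d s zs \<and>
        aspect_ratio d (convex hull (set zs)) \<ge> \<kappa>\<^sub>0 \<and>
        1 / scaling (A s zs) \<ge>
          C * (real d * ln (aspect_ratio d (convex hull (set zs))) / ln (real d))))"
proof (rule exI[of _ "1/400"], intro conjI allI impI)
  fix d :: nat and A s and \<kappa>\<^sub>0 :: real
  assume d: "d \<ge> 2" and A: "streaming_algorithm d A" "monotone_algorithm d A" "solves_rounding d A"
    and s: "valid_rounding d s"
  have ell: "ellipsoid d (ellips s)" using s by (simp add: valid_rounding_def)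
  obtain e where e: "e \<ge> 1" "\<And>x. x \<in> ellips s \<Longrightarrow> norm x \<le> e"
    using ellipsoid_bounded[OF ell] by blast
  define r where "r = norm (center s) + e"
  have r: "r \<ge> 1" using e by (simp add: r_def add_increasing)
  have inner_s: "x \<in> Rd d \<and> norm x \<le> r" if x: "x \<in> inner_body s" for x
  proof -
    obtain y where y: "y \<in> ellips s" "x = center s + scaling s *\<^sub>R y"
      using x by (auto simp: inner_body_def)
    have sc: "0 < scaling s" "scaling s \<le> 1" "center s \<in> Rd d"
      using s by (auto simp: valid_rounding_def)
    have "scaling s * norm y \<le> 1 * e" using sc e(2)[OF y(1)] by (intro mult_mono) auto
    hence "norm x \<le> r"
      using norm_triangle_ineq[of "center s" "scaling s *\<^sub>R y"] sc y by (simp add: r_def)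
    thus ?thesis
      using y sc ellipsoid_subset_Rd[OF ell] subspace_Rd[of d]
      by (auto simp: subspace_add subspace_scale subset_iff)
  qed
  \<comment> \<open>Half-axes of length at least \<open>real d * r\<close> make the cross-polytope
    contain the ball of radius \<open>r\<close>, hence the initial inner body and the unit
    ball.\<close>
  define L where "L = real d * r"
  have L: "L \<ge> 1" using d r mult_mono[of 1 "real d" 1 r] by (simp add: L_def)
  define P where "P = max 1 \<kappa>\<^sub>0 * L"
  have P: "P \<ge> L" using mult_right_mono[of 1 "max 1 \<kappa>\<^sub>0" L] L by (simp add: P_def)
  \<comment> \<open>The long first axis makes the aspect ratio at least \<open>\<kappa>\<^sub>0\<close>; it does not depend on
    \<open>R\<close>, which is chosen last.\<close>
  define l where "l = (\<lambda>i::nat. if i = 0 then P else L)"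
  define zs0 where "zs0 = map (\<lambda>i. l i *\<^sub>R unit_vec i) [0..<d] @ map (\<lambda>i. - (l i *\<^sub>R unit_vec i)) [0..<d]"
  have l_in: "l i *\<^sub>R unit_vec i \<in> set zs0" "- (l i *\<^sub>R unit_vec i) \<in> set zs0" if "i < d" for i
    using that by (auto simp: zs0_def)
  have zs0_cases: "\<exists>i<d. z = l i *\<^sub>R unit_vec i \<or> z = - (l i *\<^sub>R unit_vec i)" if "z \<in> set zs0" for z
    using that by (auto simp: zs0_def)
  have sub0: "set zs0 \<subseteq> Rd d"
    using subspace_Rd[of d] zs0_cases by (force simp: subspace_scale subspace_neg)
  have cross: "x \<in> convex hull (set zs0)" if "x \<in> Rd d" "norm x \<le> r" for x
    using d r P by (intro ball_subset_cross_polytope[OF _ _ _ l_in that]) (auto simp: l_def L_def)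
  have adm0: "admissible_stream d s zs0"
    using sub0 cross inner_s by (auto simp: admissible_stream_def)
  have "valid_rounding d (A s zs0)"
    using A(1) s sub0 by (auto simp: streaming_algorithm_def)
  then obtain b where b: "b \<ge> 1" "\<And>x. x \<in> ellips (A s zs0) \<Longrightarrow> norm x \<le> b"
    using ellipsoid_bounded[of d "ellips (A s zs0)"] by (auto simp: valid_rounding_def)
  define \<delta> where "\<delta> = real d"
  have \<delta>: "\<delta> \<ge> 2" using d by (simp add: \<delta>_def)
  \<comment> \<open>\<open>R\<close> comes after \<open>b\<close>, which depends on the answer of
    the algorithm to \<open>zs0\<close>.\<close>
  obtain R where R_large: "R > 1" "\<delta> * ln b + \<delta> * ln (\<delta> * ln R / 100) < \<delta> * ln R / 4"
    "P + (6 * (\<delta> * ln R / 100) + 1) * (2 * R) \<le> R\<^sup>2"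
    using large_radius_exists[of \<delta> P "\<delta> * ln b"] \<delta> P L by auto
  \<comment> \<open>The divisor 100 works because \<open>23/100 + 1/4 < 1/2\<close>: the potential
    of a game that ends below \<open>M\<close> is then less than
    \<open>\<delta> / 2 * ln R\<close>.\<close>
  define M where "M = \<delta> * ln R / 100"
  have M: "M \<ge> 0" using R_large(1) \<delta> by (simp add: M_def)
  interpret adversary d A s zs0 L P b R
  proof
    fix z assume "z \<in> set zs0"
    then obtain i where i: "i < d" "z = l i *\<^sub>R unit_vec i \<or> z = - (l i *\<^sub>R unit_vec i)"
      using zs0_cases by blast
    show "norm z \<le> P" using i P L by (auto simp: l_def)
    show "\<bar>coord z (d - 1)\<bar> \<le> L" using i d L by (auto simp: l_def coord_simps)
  qed (use d A s adm0 b R_large in auto)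
  obtain n zs where zs: "reached n zs" "real n \<le> 6 * M + 1"
    "M \<le> stretch zs \<or>
     real (d - 1) * ln R \<le> real d * ln b + 23 * stretch zs + real d * ln (stretch zs)"
    using game_ends[OF M] by blast
  from zs(1) have adm: "admissible_stream d s zs" and sub: "set zs0 \<subseteq> set zs"
    and bd: "\<And>z. z \<in> set zs \<Longrightarrow> norm z \<le> P + real n * (2 * R)"
    and wd: "\<And>z. z \<in> set zs \<Longrightarrow> \<bar>coord z (d - 1)\<bar> \<le> L"
    by (auto simp: reached_def)
  have subR: "set zs \<subseteq> Rd d" using adm by (simp add: admissible_stream_def)
  have stretch: "M \<le> stretch zs"
  proof (rule ccontr)
    assume "\<not> M \<le> stretch zs"
    hence less: "stretch zs < M"
      and le: "(\<delta> - 1) * ln R \<le> \<delta> * ln b + 23 * stretch zs + \<delta> * ln (stretch zs)"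
      using zs(3) d by (auto simp: \<delta>_def of_nat_diff)
    have "\<delta> * ln (stretch zs) \<le> \<delta> * ln M"
      using less stretch_ge_1[OF subR] \<delta> by (intro mult_left_mono) auto
    moreover have "\<delta> / 2 * ln R \<le> (\<delta> - 1) * ln R"
      using \<delta> R_large(1) by (intro mult_right_mono) auto
    moreover have "0 \<le> \<delta> * ln R" using \<delta> R_large(1) by simp
    ultimately show False using le less R_large(2) unfolding M_def by argo
  qed
  define K where "K = convex hull (set zs)"
  have KR: "K \<subseteq> Rd d" unfolding K_def
    by (rule hull_minimal[OF subR]) (rule subspace_imp_convex[OF subspace_Rd])
  have "P + real n * (2 * R) \<le> P + (6 * M + 1) * (2 * R)"
    using zs(2) R_large(1) by (intro add_left_mono mult_right_mono) auto
  also have "\<dots> \<le> R\<^sup>2" using R_large(3) by (simp add: M_def)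
  finally have bd': "norm z \<le> R\<^sup>2" if "z \<in> set zs" for z using bd[OF that] by linarith
  have K_norm: "norm x \<le> R\<^sup>2" if "x \<in> K" for x
    using norm_convex_hull_le[of x "set zs"] that bd' by (simp add: K_def)
  have K_width: "\<bar>coord x (d - 1)\<bar> \<le> L" if "x \<in> K" for x
    using abs_coord_convex_hull_le[of x "set zs"] that wd by (simp add: K_def)
  have K0: "x \<in> K" if "x \<in> set zs0" for x
    using that sub hull_subset[of "set zs" convex] by (auto simp: K_def)
  have "P *\<^sub>R unit_vec 0 \<in> K" "- (P *\<^sub>R unit_vec 0) \<in> K"
    using K0 l_in[of 0] d by (simp_all add: l_def)
  note circ = circumradius_bounds[OF _ KR K_norm this]
  have circ1: "P \<le> circumradius d K" and circ2: "circumradius d K \<le> R\<^sup>2"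
    using circ P L R_large by auto
  have "L *\<^sub>R unit_vec (d - 1) \<in> K" "- (L *\<^sub>R unit_vec (d - 1)) \<in> K"
    using K0 l_in[of "d - 1"] d by (simp_all add: l_def)
  moreover have "unit_ball d \<subseteq> K"
    using cross r hull_mono[OF sub, of convex] by (force simp: unit_ball_def K_def)
  ultimately have inr: "1 \<le> inradius d K" "inradius d K \<le> L"
    using inradius_bounds[of "d - 1" d L K] K_width d L by auto
  have "max 1 \<kappa>\<^sub>0 = P / L" using L by (simp add: P_def)
  also have "\<dots> \<le> aspect_ratio d K" unfolding aspect_ratio_def
    using circ1 inr P L by (intro frac_le) auto
  finally have asp1: "max 1 \<kappa>\<^sub>0 \<le> aspect_ratio d K" .
  have "aspect_ratio d K \<le> R\<^sup>2 / 1" unfolding aspect_ratio_def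
    using circ2 inr by (intro frac_le) auto
  hence "ln (aspect_ratio d K) \<le> ln (R\<^sup>2)" using asp1 by (intro ln_mono) auto
  hence asp2: "ln (aspect_ratio d K) \<le> 2 * ln R" using R_large by (simp add: ln_realpow)
  have "ln 2 \<le> ln (real d)" using d by simp
  hence lnd: "1/2 \<le> ln (real d)" using ln2_ge_two_thirds by linarith
  \<comment> \<open>The factor 400 is 100 from \<open>M\<close>, times 2 from the square of
    \<open>R\<close>, times 2 from \<open>ln (real d) \<ge> 1/2\<close>.\<close>
  have "1/400 * (real d * ln (aspect_ratio d K) / ln (real d)) \<le> 1/400 * (real d * (2 * ln R) / (1/2))"
    using asp1 asp2 lnd R_large by (intro mult_left_mono frac_le) auto
  also have "\<dots> = M" by (simp add: M_def \<delta>_def)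
  also have "\<dots> \<le> 1 / scaling (A s zs)" using stretch by (simp add: stretch_def)
  finally show "\<exists>zs. admissible_stream d s zs \<and>
        \<kappa>\<^sub>0 \<le> aspect_ratio d (convex hull (set zs)) \<and>
        1/400 * (real d * ln (aspect_ratio d (convex hull (set zs))) / ln (real d))
          \<le> 1 / scaling (A s zs)"
    using adm asp1 unfolding K_def by (intro exI[of _ zs]) auto
qed simp

end
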